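(* Let $G$ be a group and let $\ell: G \to [0,+\infty)$ be a homogeneous pseudo-length function. Then there exist a real Banach space $\mathbb{B} = (\mathbb{B},\|\cdot\|)$ and a group homomorphism $\phi : G \to \mathbb{B}$ (where $\mathbb{B}$ is viewed as a group under addition) such that $\ell(x) = \|\phi(x)\|$ for all $x \in G$. Furthermore, if $\ell$ is a length function, one can take $\phi$ to be injective.
   Context: Let $G$ be a group, written multiplicatively, with identity $e$. A pseudo-length function on $G$ is a map $\ell: G \to [0,+\infty)$ such that $\ell(e)=0$, $\ell(x^{-1})=\ell(x)$ and $\ell(xy)\le \ell(x)+\ell(y)$ for all $x,y\in G$. It is a length function if in addition $\ell(x)>0$ for all $x \in G\setminus\{e\}$. It is homogeneous if $\ell(x^n)=|n|\,\ell(x)$ for all $x\in G$ and all $n\in\mathbb{Z}$. *)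

theory Defs
  imports "HOL-Algebra.Algebra" "HOL-Analysis.Analysis"
begin

definition pseudo_length_function :: "('a, 'm) monoid_scheme \<Rightarrow> ('a \<Rightarrow> real) \<Rightarrow> bool" where
  "pseudo_length_function G l \<longleftrightarrow>
     (\<forall>x\<in>carrier G. 0 \<le> l x) \<and>
     l \<one>\<^bsub>G\<^esub> = 0 \<and>
     (\<forall>x\<in>carrier G. l (inv\<^bsub>G\<^esub> x) = l x) \<and>
     (\<forall>x\<in>carrier G. \<forall>y\<in>carrier G. l (x \<otimes>\<^bsub>G\<^esub> y) \<le> l x + l y)"

definition length_function :: "('a, 'm) monoid_scheme \<Rightarrow> ('a \<Rightarrow> real) \<Rightarrow> bool" where
  "length_function G l \<longleftrightarrow>
     pseudo_length_function G l \<and> (\<forall>x\<in>carrier G - {\<one>\<^bsub>G\<^esub>}. 0 < l x)"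

definition homogeneous :: "('a, 'm) monoid_scheme \<Rightarrow> ('a \<Rightarrow> real) \<Rightarrow> bool" where
  "homogeneous G l \<longleftrightarrow>
     (\<forall>x\<in>carrier G. \<forall>n::int. l (x [^]\<^bsub>G\<^esub> n) = \<bar>real_of_int n\<bar> * l x)"

definition real_field :: "real ring" where
  "real_field = \<lparr>carrier = UNIV, monoid.mult = (*), one = 1, ring.zero = 0, add = (+)\<rparr>"

text \<open>
  Banach spaces are represented with an explicit carrier, since the existence of a Banach space
  cannot be expressed by quantifying over the types of class \<open>banach\<close>. The fields \<open>mult\<close> and \<open>one\<close>
  which the module record inherits from rings play no role.

  An existence statement about Banach spaces must fix the type of their elements. For a group with
  elements of type \<open>'a\<close>, the type \<open>('a \<Rightarrow> real) \<Rightarrow> real\<close> is large enough: the closed linear span of the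
  image of a homogeneous pseudo-length preserving homomorphism is \<open>{0}\<close> if the group is finite, and
  otherwise has at most as many elements as there are functions from the group to the reals.
\<close>

locale real_normed_space = module real_field B
  for B :: "(real, 'b) module" (structure) +
  fixes nrm :: "'b \<Rightarrow> real"
  assumes nrm_nonneg: "x \<in> carrier B \<Longrightarrow> 0 \<le> nrm x"
    and nrm_eq_0_iff: "x \<in> carrier B \<Longrightarrow> nrm x = 0 \<longleftrightarrow> x = \<zero>\<^bsub>B\<^esub>"
    and nrm_triangle: "\<lbrakk>x \<in> carrier B; y \<in> carrier B\<rbrakk> \<Longrightarrow> nrm (x \<oplus>\<^bsub>B\<^esub> y) \<le> nrm x + nrm y"
    and nrm_smult: "x \<in> carrier B \<Longrightarrow> nrm (a \<odot>\<^bsub>B\<^esub> x) = \<bar>a\<bar> * nrm x"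

text \<open>
  The value 0 outside the carrier is needed because \<^locale>\<open>Metric_space\<close> requires symmetry and
  nonnegativity of the distance on the whole type.
\<close>

definition norm_dist :: "(real, 'b) module \<Rightarrow> ('b \<Rightarrow> real) \<Rightarrow> 'b \<Rightarrow> 'b \<Rightarrow> real" where
  "norm_dist B nrm x y =
     (if x \<in> carrier B \<and> y \<in> carrier B then nrm (x \<ominus>\<^bsub>B\<^esub> y) else 0)"

locale real_banach_space = real_normed_space +
  assumes complete: "Metric_space.mcomplete (carrier B) (norm_dist B nrm)"

lemma cring_real_field: "cring real_field"
proof (rule cringI)
  show "abelian_group real_field"
  proof (rule abelian_groupI)
    fix x assume "x \<in> carrier real_field"
    show "\<exists>y\<in>carrier real_field. y \<oplus>\<^bsub>real_field\<^esub> x = \<zero>\<^bsub>real_field\<^esub>"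
      by (rule bexI[of _ "- x"]) (simp_all add: real_field_def)
  qed (simp_all add: real_field_def)
  show "Group.comm_monoid real_field"
    by (rule comm_monoidI) (simp_all add: real_field_def)
qed (simp_all add: real_field_def distrib_right)

context real_normed_space
begin

lemma nrm_minus:
  assumes "x \<in> carrier B"
  shows "nrm (\<ominus>\<^bsub>B\<^esub> x) = nrm x"
proof -
  have "\<ominus>\<^bsub>B\<^esub> x = (-1) \<odot>\<^bsub>B\<^esub> x"
  proof (rule M.minus_equality)
    have one: "x = 1 \<odot>\<^bsub>B\<^esub> x"
      using smult_one[OF assms] by (simp add: real_field_def)
    have "(-1) \<odot>\<^bsub>B\<^esub> x \<oplus>\<^bsub>B\<^esub> 1 \<odot>\<^bsub>B\<^esub> x = (-1 + 1) \<odot>\<^bsub>B\<^esub> x"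
      using smult_l_distr[of "-1" 1 x] assms by (simp add: real_field_def)
    also have "\<dots> = \<zero>\<^bsub>B\<^esub>"
      using nrm_smult[of x 0] nrm_eq_0_iff[of "0 \<odot>\<^bsub>B\<^esub> x"] smult_closed[of 0 x] assms
      by (simp add: real_field_def)
    finally show "(-1) \<odot>\<^bsub>B\<^esub> x \<oplus>\<^bsub>B\<^esub> x = \<zero>\<^bsub>B\<^esub>" using one by simp
  next
    show "(-1) \<odot>\<^bsub>B\<^esub> x \<in> carrier B" 
      using smult_closed[of "-1" x] assms by (simp add: real_field_def)
  qed (fact assms)
  then show ?thesis using nrm_smult[of x "-1"] assms by simp
qed

lemma Metric_space_norm_dist: "Metric_space (carrier B) (norm_dist B nrm)"
proof
  fix x y
  show "0 \<le> norm_dist B nrm x y"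
    by (simp add: norm_dist_def nrm_nonneg)
  show "norm_dist B nrm x y = norm_dist B nrm y x"
  proof (cases "x \<in> carrier B \<and> y \<in> carrier B")
    case True
    then have "\<ominus>\<^bsub>B\<^esub> (x \<ominus>\<^bsub>B\<^esub> y) = y \<ominus>\<^bsub>B\<^esub> x"
      by (simp add: a_minus_def M.minus_add M.a_comm)
    then show ?thesis
      using True nrm_minus[of "x \<ominus>\<^bsub>B\<^esub> y"] by (simp add: norm_dist_def)
  qed (auto simp: norm_dist_def)
next
  fix x y assume "x \<in> carrier B" "y \<in> carrier B"
  then show "norm_dist B nrm x y = 0 \<longleftrightarrow> x = y"
    using M.minus_equality[of x "\<ominus>\<^bsub>B\<^esub> y"] M.r_neg[of y] 
    by (auto simp: norm_dist_def nrm_eq_0_iff a_minus_def)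
next
  fix x y z assume *: "x \<in> carrier B" "y \<in> carrier B" "z \<in> carrier B"
  have "(x \<ominus>\<^bsub>B\<^esub> y) \<oplus>\<^bsub>B\<^esub> (y \<ominus>\<^bsub>B\<^esub> z) = x \<ominus>\<^bsub>B\<^esub> z"
    using * by (simp add: a_minus_def M.a_assoc M.r_neg1)
  then show "norm_dist B nrm x z \<le> norm_dist B nrm x y + norm_dist B nrm y z"
    using * nrm_triangle[of "x \<ominus>\<^bsub>B\<^esub> y" "y \<ominus>\<^bsub>B\<^esub> z"] by (simp add: norm_dist_def)
qed

lemma mcomplete_norm_dist_iff:
  "Metric_space.mcomplete (carrier B) (norm_dist B nrm) \<longleftrightarrow>
     (\<forall>\<sigma>. range \<sigma> \<subseteq> carrier B \<longrightarrow>
        (\<forall>\<epsilon>>0. \<exists>N. \<forall>m\<ge>N. \<forall>n\<ge>N. nrm (\<sigma> m \<ominus>\<^bsub>B\<^esub> \<sigma> n) < \<epsilon>) \<longrightarrow>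
        (\<exists>x\<in>carrier B. (\<lambda>n. nrm (\<sigma> n \<ominus>\<^bsub>B\<^esub> x)) \<longlonglongrightarrow> 0))"
proof -
  interpret MS: Metric_space "carrier B" "norm_dist B nrm"
    by (rule Metric_space_norm_dist)
  have cauchy: "MS.MCauchy \<sigma> \<longleftrightarrow>
      (\<forall>\<epsilon>>0. \<exists>N. \<forall>m\<ge>N. \<forall>n\<ge>N. nrm (\<sigma> m \<ominus>\<^bsub>B\<^esub> \<sigma> n) < \<epsilon>)"
    if "range \<sigma> \<subseteq> carrier B" for \<sigma>
  proof -
    have "\<sigma> n \<in> carrier B" for n using that by auto
    then show ?thesis using that unfolding MS.MCauchy_def norm_dist_def by simp
  qed
  have limit: "limitin MS.mtopology \<sigma> x sequentially \<longleftrightarrow>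
      x \<in> carrier B \<and> (\<lambda>n. nrm (\<sigma> n \<ominus>\<^bsub>B\<^esub> x)) \<longlonglongrightarrow> 0"
    if "range \<sigma> \<subseteq> carrier B" for \<sigma> x
  proof -
    have "\<sigma> n \<in> carrier B" for n using that by auto
    then show ?thesis
      by (auto simp: MS.limit_metric_sequentially LIMSEQ_iff norm_dist_def nrm_nonneg)
  qed
  show ?thesis
    unfolding MS.mcomplete_def using cauchy limit MS.MCauchy_def by metis
qed

end

end

theory Submission
  imports Defs
begin

text \<open>
  The proof has two halves: a homogeneous pseudo-length vanishes on commutators, so that only the
  abelianization matters, and a commutative group has enough additive functionals to recover a
  homogeneous pseudo-length from them.

  For the first half, homogeneity makes \<open>l\<close> invariant under conjugation and gives
  \<open>l x \<le> (l y + l z) / 2\<close> whenever \<open>x\<close> is conjugate both to \<open>w y\<close> and to \<open>z w\<^sup>-\<^sup>1\<close>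
  (\<open>length_le_average\<close>). With \<open>c = [x, y]\<close> and \<open>f m k = l (x\<^sup>m c\<^sup>k)\<close> this yields
  \<open>f m k \<le> (f (m - 1) k + f (m + 1) (k - 1)) / 2\<close>. So \<open>f\<close> is a submartingale for a random walk
  whose \<open>N\<close> steps from \<open>(0, N / 2)\<close> lead to \<open>(S, - S / 2)\<close> with \<open>S\<close> a sum of \<open>N\<close> independent signs.
  There \<open>f\<close> is at most a multiple of \<open>\<bar>S\<bar>\<close>, of mean at most \<open>sqrt N\<close>, while
  \<open>f 0 (N / 2) = N l c / 2\<close>; hence \<open>l c = 0\<close> (\<open>length_commutator\<close>). The random walk is replaced by an
  induction with the majorant \<open>\<bar>s\<bar> \<le> (s\<^sup>2 / t + t) / 2\<close>, as \<open>s\<^sup>2 + n\<close> is a martingale when \<open>n\<close> counts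
  the remaining steps (\<open>potential_bound\<close>).

  For the second half, \<open>l\<close> induces a sublinear function on the abelianization. A Hahn-Banach
  theorem for commutative groups (\<open>Hahn_Banach_sublinear\<close>) provides for each \<open>a\<close> an additive
  \<open>f\<close> with \<open>\<bar>f\<bar> \<le> l\<close> and \<open>f a = l a\<close> (\<open>norming_functional\<close>). Sending \<open>x\<close> to the evaluation at
  \<open>x\<close> on all such functionals is then an isometric homomorphism into a Banach space of bounded
  functions with the supremum norm.
\<close>

section \<open>Commutators have length zero\<close>

lemma nonpos_if_multiples_bounded:
  fixes a c :: real
  assumes "\<And>n::nat. real n * a \<le> c"
  shows "a \<le> 0"
proof (rule ccontr)
  assume "\<not> a \<le> 0"
  then obtain n :: nat where "c < real n * a"
    using reals_Archimedean3[of a] by auto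
  then show False using assms[of n] by simp
qed

text \<open>
  The pair \<open>(s, k)\<close> is a position of the random walk with \<open>n\<close> steps left; the relation
  \<open>2 k = n - s\<close> is kept by both moves, to \<open>(s - 1, k)\<close> and to \<open>(s + 1, k - 1)\<close>. The number \<open>t\<close> is
  free, so that the bound can be optimized over it.
\<close>

lemma potential_bound:
  fixes f :: "int \<Rightarrow> int \<Rightarrow> real"
  assumes avg: "\<And>m k. f m k \<le> (f (m - 1) k + f (m + 1) (k - 1)) / 2"
    and start: "\<And>i. f (2 * i) (- i) \<le> d * \<bar>real_of_int (2 * i)\<bar>"
    and "0 \<le> d" "0 < t"
    and "2 * k = int n - s"
  shows "f s k \<le> d * (((real_of_int s)\<^sup>2 + n) / t + t) / 2"
  using \<open>2 * k = int n - s\<close>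
proof (induction n arbitrary: s k)
  case 0
  then have s: "s = 2 * (- k)" by simp
  let ?s = "real_of_int s"
  have "0 \<le> (\<bar>?s\<bar> - t)\<^sup>2 / t" using \<open>0 < t\<close> by simp
  also have "\<dots> = (?s\<^sup>2 / t + t) - 2 * \<bar>?s\<bar>"
    using \<open>0 < t\<close> by (simp add: field_simps power2_eq_square)
  finally have "\<bar>?s\<bar> \<le> (?s\<^sup>2 / t + t) / 2" by simp
  then have "d * \<bar>?s\<bar> \<le> d * ((?s\<^sup>2 / t + t) / 2)"
    using \<open>0 \<le> d\<close> by (rule mult_left_mono)
  moreover have "f s k \<le> d * \<bar>?s\<bar>" using start[of "- k"] s by simp
  ultimately show ?case by simp
next
  case (Suc n)
  define b where "b s = d * (((real_of_int s)\<^sup>2 + n) / t + t) / 2" for s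
  have "f (s - 1) k \<le> b (s - 1)" "f (s + 1) (k - 1) \<le> b (s + 1)"
    using Suc.IH[of k "s - 1"] Suc.IH[of "k - 1" "s + 1"] Suc.prems by (simp_all add: b_def)
  then have "f s k \<le> (b (s - 1) + b (s + 1)) / 2" using avg[of s k] by simp
  also have "\<dots> = d * (((real_of_int s)\<^sup>2 + Suc n) / t + t) / 2"
    using \<open>0 < t\<close> by (simp add: b_def field_simps power2_eq_square)
  finally show ?case .
qed

text \<open>A group with a homogeneous pseudo-length function on its carrier.\<close>

locale homogeneous_pseudo_length = group G for G (structure) +
  fixes l :: "'a \<Rightarrow> real"
  assumes pseudo_length: "pseudo_length_function G l"
    and homogeneous: "homogeneous G l"
begin

lemma length_nonneg: "x \<in> carrier G \<Longrightarrow> 0 \<le> l x"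
  and length_one: "l \<one> = 0"
  and length_inv: "x \<in> carrier G \<Longrightarrow> l (inv x) = l x"
  and length_mult: "x \<in> carrier G \<Longrightarrow> y \<in> carrier G \<Longrightarrow> l (x \<otimes> y) \<le> l x + l y"
  using pseudo_length by (auto simp: pseudo_length_function_def)

lemma length_int_pow: "x \<in> carrier G \<Longrightarrow> l (x [^] (n::int)) = \<bar>real_of_int n\<bar> * l x"
  using homogeneous by (simp add: homogeneous_def)

lemma length_nat_pow: "x \<in> carrier G \<Longrightarrow> l (x [^] (n::nat)) = real n * l x"
  using length_int_pow[of x "int n"] by (simp add: int_pow_int)

lemma mult_inv_cancel:
  assumes "x \<in> carrier G" "y \<in> carrier G"
  shows "x \<otimes> (inv x \<otimes> y) = y" "inv x \<otimes> (x \<otimes> y) = y"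
  using assms by (simp_all add: m_assoc[symmetric])

lemma conj_nat_pow:
  assumes "g \<in> carrier G" "x \<in> carrier G"
  shows "(g \<otimes> x \<otimes> inv g) [^] (n::nat) = g \<otimes> x [^] n \<otimes> inv g"
  by (induction n) (simp_all add: assms m_assoc mult_inv_cancel)

text \<open>
  The \<open>n\<close>-th power of a conjugate is the conjugate of the \<open>n\<close>-th power, so conjugation by \<open>g\<close>
  costs at most \<open>2 * l g\<close> however large \<open>n\<close> is.
\<close>

lemma length_conj_le:
  assumes g: "g \<in> carrier G" and x: "x \<in> carrier G"
  shows "l (g \<otimes> x \<otimes> inv g) \<le> l x"
proof -
  have "real n * (l (g \<otimes> x \<otimes> inv g) - l x) \<le> 2 * l g" for n
  proof -
    have "real n * l (g \<otimes> x \<otimes> inv g) = l (g \<otimes> x [^] n \<otimes> inv g)"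
      using length_nat_pow[of "g \<otimes> x \<otimes> inv g" n] by (simp add: conj_nat_pow g x)
    also have "\<dots> \<le> l g + l (x [^] n) + l (inv g)"
      using length_mult[of "g \<otimes> x [^] n" "inv g"] length_mult[of g "x [^] n"] g x by simp
    finally show ?thesis using g x by (simp add: length_inv length_nat_pow algebra_simps)
  qed
  then show ?thesis using nonpos_if_multiples_bounded by fastforce
qed

lemma length_conj:
  assumes g: "g \<in> carrier G" and x: "x \<in> carrier G"
  shows "l (g \<otimes> x \<otimes> inv g) = l x"
proof (rule antisym)
  have "inv g \<otimes> (g \<otimes> x \<otimes> inv g) \<otimes> inv (inv g) = x"
    using g x by (simp add: m_assoc mult_inv_cancel)
  then show "l x \<le> l (g \<otimes> x \<otimes> inv g)"
    using length_conj_le[of "inv g" "g \<otimes> x \<otimes> inv g"] g x by simp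
qed (rule length_conj_le[OF assms])

text \<open>
  Apart from fixed factors, \<open>x [^] (2 * n)\<close> is \<open>(w \<otimes> y) [^] n \<otimes> u \<otimes> (z \<otimes> inv w) [^] n\<close>. Peeling
  off the outermost \<open>w\<close> and \<open>inv w\<close> by conjugation invariance leaves one \<open>y\<close> and one \<open>z\<close> per
  step, so its length grows by at most \<open>l y + l z\<close> for every two factors \<open>x\<close>. Here
  \<open>u = inv s \<otimes> t\<close>.
\<close>

lemma length_le_average:
  assumes [simp]: "s \<in> carrier G" "t \<in> carrier G" "w \<in> carrier G" "y \<in> carrier G" "z \<in> carrier G"
    and x1: "x = s \<otimes> (w \<otimes> y) \<otimes> inv s" and x2: "x = t \<otimes> (z \<otimes> inv w) \<otimes> inv t"
  shows "l x \<le> (l y + l z) / 2"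
proof -
  have [simp]: "x \<in> carrier G" by (simp add: x1)
  define a b u where "a = w \<otimes> y" and "b = z \<otimes> inv w" and "u = inv s \<otimes> t"
  have [simp]: "a \<in> carrier G" "b \<in> carrier G" "u \<in> carrier G"
    by (simp_all add: a_def b_def u_def)
  have middle: "l (a [^] n \<otimes> u \<otimes> b [^] n) \<le> real n * (l y + l z) + l u" for n
  proof (induction n)
    case (Suc n)
    let ?v = "a [^] n \<otimes> u \<otimes> b [^] n"
    have "a [^] Suc n \<otimes> u \<otimes> b [^] Suc n = a \<otimes> ?v \<otimes> b"
      by (subst nat_pow_Suc2) (simp_all add: m_assoc)
    also have "\<dots> = w \<otimes> (y \<otimes> ?v \<otimes> z) \<otimes> inv w"
      by (simp add: a_def b_def m_assoc)
    finally have "l (a [^] Suc n \<otimes> u \<otimes> b [^] Suc n) = l (y \<otimes> ?v \<otimes> z)"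
      by (simp only: length_conj m_closed assms nat_pow_closed \<open>a \<in> carrier G\<close> \<open>b \<in> carrier G\<close>
          \<open>u \<in> carrier G\<close>)
    also have "\<dots> \<le> l y + l ?v + l z"
      using length_mult[of "y \<otimes> ?v" z] length_mult[of y ?v] by simp
    finally show ?case using Suc by (simp add: algebra_simps)
  qed simp
  have "real n * (2 * l x - (l y + l z)) \<le> l s + l u + l t" for n
  proof -
    let ?v = "a [^] n \<otimes> u \<otimes> b [^] n"
    have "real (n + n) * l x = l (x [^] n \<otimes> x [^] n)"
      using length_nat_pow[of x "n + n"] by (simp add: nat_pow_mult)
    also have "x [^] n \<otimes> x [^] n = (s \<otimes> a [^] n \<otimes> inv s) \<otimes> (t \<otimes> b [^] n \<otimes> inv t)"
      using conj_nat_pow[of s a n] conj_nat_pow[of t b n] x1 x2 by (simp add: a_def b_def)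
    also have "\<dots> = s \<otimes> ?v \<otimes> inv t"
      by (simp add: u_def m_assoc)
    also have "l (s \<otimes> ?v \<otimes> inv t) \<le> l s + l ?v + l t"
      using length_mult[of "s \<otimes> ?v" "inv t"] length_mult[of s ?v] by (simp add: length_inv)
    finally show ?thesis using middle[of n] by (simp add: algebra_simps)
  qed
  then show ?thesis using nonpos_if_multiples_bounded by fastforce
qed

lemma length_commutator:
  assumes [simp]: "x \<in> carrier G" "y \<in> carrier G"
  shows "l (x \<otimes> y \<otimes> inv x \<otimes> inv y) = 0"
proof -
  define c where "c = x \<otimes> y \<otimes> inv x \<otimes> inv y"
  have [simp]: "c \<in> carrier G" by (simp add: c_def)
  define f where "f m k = l (x [^] m \<otimes> c [^] k)" for m k :: int
  have avg: "f m k \<le> (f (m - 1) k + f (m + 1) (k - 1)) / 2" for m k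
  proof -
    let ?v = "x [^] m \<otimes> c [^] (k - 1)"
    have x: "x [^] m = x \<otimes> x [^] (m - 1)" and x': "x [^] (m + 1) = x \<otimes> x [^] m"
      and c: "c [^] k = c [^] (k - 1) \<otimes> c"
      using int_pow_mult[of x 1 "m - 1"] int_pow_mult[of x 1 m] int_pow_mult[of c "k - 1" 1]
      by (simp_all add: add.commute)
    \<comment> \<open>Here \<open>x\<close> plays the role of \<open>w\<close>: it is the first letter of \<open>x [^] m\<close>, and \<open>inv x\<close> occurs
      in the last factor \<open>c\<close>, followed only by \<open>inv y\<close>, which is removed by conjugation.\<close>
    have "f m k \<le> (f (m - 1) k + l (inv y \<otimes> (?v \<otimes> x) \<otimes> y)) / 2"
      unfolding f_def
    proof (rule length_le_average[where s = \<one> and w = x and t = y])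
      show "x [^] m \<otimes> c [^] k = \<one> \<otimes> (x \<otimes> (x [^] (m - 1) \<otimes> c [^] k)) \<otimes> inv \<one>"
        by (simp add: x m_assoc)
      have "x [^] m \<otimes> c [^] k = ?v \<otimes> c" by (simp add: c m_assoc)
      also have "\<dots> = y \<otimes> (inv y \<otimes> (?v \<otimes> x) \<otimes> y \<otimes> inv x) \<otimes> inv y"
        by (subst (2) c_def) (simp add: m_assoc mult_inv_cancel)
      finally show "x [^] m \<otimes> c [^] k = y \<otimes> (inv y \<otimes> (?v \<otimes> x) \<otimes> y \<otimes> inv x) \<otimes> inv y" .
    qed simp_all
    also have "l (inv y \<otimes> (?v \<otimes> x) \<otimes> y) = l (?v \<otimes> x)"
      using length_conj[of "inv y" "?v \<otimes> x"] by simp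
    also have "\<dots> = l (x \<otimes> (?v \<otimes> x) \<otimes> inv x)"
      by (simp only: length_conj m_closed int_pow_closed assms \<open>c \<in> carrier G\<close>)
    also have "x \<otimes> (?v \<otimes> x) \<otimes> inv x = x [^] (m + 1) \<otimes> c [^] (k - 1)"
      by (simp add: x' m_assoc)
    finally show ?thesis by (simp add: f_def)
  qed
  define d where "d = l x + l c / 2"
  have "0 \<le> d" by (simp add: d_def length_nonneg)
  have start: "f (2 * i) (- i) \<le> d * \<bar>real_of_int (2 * i)\<bar>" for i
  proof -
    have "f (2 * i) (- i) \<le> \<bar>real_of_int (2 * i)\<bar> * l x + \<bar>real_of_int (- i)\<bar> * l c"
      unfolding f_def
      using length_mult[of "x [^] (2 * i)" "c [^] (- i)"] length_int_pow[of x "2 * i"]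
        length_int_pow[of c "- i"] by simp
    then show ?thesis by (simp add: d_def algebra_simps)
  qed
  have "real n * l c \<le> d" for n
  proof (cases "n = 0")
    case False
    \<comment> \<open>A walk of \<open>4 * n\<^sup>2\<close> steps, with \<open>t\<close> the square root of this number.\<close>
    then have "f 0 (2 * int n ^ 2) \<le> d * ((0\<^sup>2 + real (4 * n\<^sup>2)) / (2 * real n) + 2 * real n) / 2"
      using potential_bound[OF avg start \<open>0 \<le> d\<close>, of "2 * real n" "2 * int n ^ 2" "4 * n\<^sup>2" 0] by simp
    also have "\<dots> = 2 * real n * d"
      using False by (simp add: field_simps power2_eq_square)
    also have "f 0 (2 * int n ^ 2) = 2 * real n * (real n * l c)"
      using length_int_pow[of c "2 * int n ^ 2"] by (simp add: f_def power2_eq_square)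
    finally show ?thesis using False by simp
  qed (simp add: \<open>0 \<le> d\<close>)
  then have "l c \<le> 0" by (rule nonpos_if_multiples_bounded)
  then show ?thesis using length_nonneg[of c] by (simp add: c_def)
qed

lemma length_derived:
  assumes "k \<in> derived G (carrier G)"
  shows "l k = 0"
proof -
  have gen: "generate G (derived_set G (carrier G)) \<subseteq> carrier G"
    using derived_in_carrier[of "carrier G"] by (simp add: derived_def)
  have "k \<in> generate G (derived_set G (carrier G))"
    using assms by (simp add: derived_def)
  then show ?thesis
  proof (induction rule: generate.induct)
    case one
    show ?case by (rule length_one)
  next
    case (incl h)
    then show ?case by (auto simp: length_commutator)
  next
    case (inv h)
    then show ?case by (auto simp: length_commutator length_inv)
  next
    case (eng h1 h2)
    then have "h1 \<in> carrier G" "h2 \<in> carrier G" using gen by auto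
    then show ?case
      using length_mult[of h1 h2] length_nonneg[of "h1 \<otimes> h2"] eng.IH by simp
  qed
qed

end

section \<open>The Hahn-Banach theorem for commutative groups\<close>

text \<open>
  Subadditive functions that are homogeneous for natural exponents only, so that in general
  \<open>p (inv x)\<close> is unrelated to \<open>p x\<close> apart from \<open>sublinear_ge_uminus_inv\<close> below.
\<close>

definition sublinear :: "('a, 'm) monoid_scheme \<Rightarrow> ('a \<Rightarrow> real) \<Rightarrow> bool" where
  "sublinear G p \<longleftrightarrow>
     (\<forall>x\<in>carrier G. \<forall>y\<in>carrier G. p (x \<otimes>\<^bsub>G\<^esub> y) \<le> p x + p y) \<and>
     (\<forall>x\<in>carrier G. \<forall>n::nat. p (x [^]\<^bsub>G\<^esub> n) = real n * p x)"

lemma sublinear_mult: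
  "sublinear G p \<Longrightarrow> x \<in> carrier G \<Longrightarrow> y \<in> carrier G \<Longrightarrow> p (x \<otimes>\<^bsub>G\<^esub> y) \<le> p x + p y"
  by (simp add: sublinear_def)

lemma sublinear_pow:
  "sublinear G p \<Longrightarrow> x \<in> carrier G \<Longrightarrow> p (x [^]\<^bsub>G\<^esub> (n::nat)) = real n * p x"
  by (simp add: sublinear_def)

lemma (in group) sublinear_one:
  assumes "sublinear G p"
  shows "p \<one> = 0"
  using sublinear_pow[OF assms one_closed, of 0] by simp

lemma (in group) sublinear_ge_uminus_inv:
  assumes "sublinear G p" "x \<in> carrier G"
  shows "- p (inv x) \<le> p x"
  using sublinear_mult[OF assms(1), of x "inv x"] assms by (simp add: sublinear_one)

text \<open>
  The function \<open>q\<close> is the pointwise infimum, and by monotonicity the limit, of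
  \<open>p (z \<otimes> a [^] k) - k * p a\<close> over \<open>k\<close>. If \<open>p\<close> is minimal, then \<open>q = p\<close>, and the third property
  becomes \<open>p z + p a \<le> p (z \<otimes> a)\<close>; for arbitrary \<open>p\<close>, the case \<open>z = inv a\<close> gives
  \<open>q (inv a) \<le> - p a\<close>.
\<close>

lemma (in comm_group) sublinear_reduction:
  assumes p: "sublinear G p" and a[simp]: "a \<in> carrier G"
  obtains q where "sublinear G q" "\<And>z. z \<in> carrier G \<Longrightarrow> q z \<le> p z"
    "\<And>z. z \<in> carrier G \<Longrightarrow> q z \<le> p (z \<otimes> a) - p a"
    "\<And>z. z \<notin> carrier G \<Longrightarrow> q z = p z"
proof
  define g where "g z k = p (z \<otimes> a [^] k) - real k * p a" for z and k :: nat
  define q where "q z = (if z \<in> carrier G then INF k. g z k else p z)" for z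
  have lower: "- p (inv z) \<le> g z k" if [simp]: "z \<in> carrier G" for z k
  proof -
    have "p (inv z \<otimes> (z \<otimes> a [^] k)) \<le> p (inv z) + p (z \<otimes> a [^] k)"
      by (rule sublinear_mult[OF p]) auto
    also have "inv z \<otimes> (z \<otimes> a [^] k) = a [^] k" by (simp add: m_assoc[symmetric])
    finally show ?thesis using sublinear_pow[OF p a, of k] by (simp add: g_def)
  qed
  have bdd: "bdd_below (range (g z))" if "z \<in> carrier G" for z
    using lower[OF that] by (rule bdd_belowI2)
  have q_le: "q z \<le> g z k" if "z \<in> carrier G" for z k
    using cINF_lower[OF bdd[OF that]] that by (simp add: q_def)
  have le_q: "c \<le> q z" if "z \<in> carrier G" "\<And>k. c \<le> g z k" for c z
    using that by (auto simp: q_def intro!: cINF_greatest)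
  have antimono_g: "g z j \<le> g z k" if [simp]: "z \<in> carrier G" and "k \<le> j" for z j k
  proof -
    have "antimono (g z)"
    proof (rule decseq_SucI)
      fix i :: nat
      have "p (z \<otimes> a [^] i \<otimes> a) \<le> p (z \<otimes> a [^] i) + p a"
        by (rule sublinear_mult[OF p]) auto
      then show "g z (Suc i) \<le> g z i" by (simp add: g_def m_assoc algebra_simps)
    qed
    then show ?thesis using \<open>k \<le> j\<close> by (rule antimonoD)
  qed
  have g_pow: "g (z [^] n) (k * n) = real n * g z k" if [simp]: "z \<in> carrier G" for z k and n :: nat
  proof -
    have "z [^] n \<otimes> a [^] (k * n) = (z \<otimes> a [^] k) [^] n"
      by (simp add: pow_mult_distrib m_comm nat_pow_pow)
    then show ?thesis by (simp add: g_def sublinear_pow[OF p] algebra_simps)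
  qed
  show "sublinear G q"
    unfolding sublinear_def
  proof (intro conjI ballI allI)
    fix x y assume [simp]: "x \<in> carrier G" "y \<in> carrier G"
    have sum: "q (x \<otimes> y) \<le> g x i + g y j" for i j
    proof -
      have "(x \<otimes> a [^] i) \<otimes> (y \<otimes> a [^] j) = (x \<otimes> y) \<otimes> a [^] (i + j)"
        by (simp add: nat_pow_mult[symmetric] m_ac)
      then have "g (x \<otimes> y) (i + j) \<le> g x i + g y j"
        using sublinear_mult[OF p, of "x \<otimes> a [^] i" "y \<otimes> a [^] j"]
        by (simp add: g_def algebra_simps)
      then show ?thesis using q_le[of "x \<otimes> y" "i + j"] by simp
    qed
    have "q (x \<otimes> y) - g x i \<le> q y" for i
      by (rule le_q) (use sum[of i] in \<open>auto simp: algebra_simps\<close>)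
    then have "q (x \<otimes> y) - q y \<le> q x"
      by (intro le_q) (auto simp: algebra_simps)
    then show "q (x \<otimes> y) \<le> q x + q y" by simp
  next
    fix x and n :: nat assume [simp]: "x \<in> carrier G"
    show "q (x [^] n) = real n * q x"
    proof (cases "n = 0")
      case True
      have "g \<one> k = 0" for k by (simp add: g_def sublinear_pow[OF p])
      then show ?thesis using True by (simp add: q_def)
    next
      case False
      have "q (x [^] n) / real n \<le> q x"
      proof (rule le_q)
        fix k
        show "q (x [^] n) / real n \<le> g x k"
          using q_le[of "x [^] n" "k * n"] False by (simp add: g_pow field_simps)
      qed simp
      \<comment> \<open>By \<open>g_pow\<close> only exponents divisible by \<open>n\<close> can be compared with those of \<open>x\<close>;
        monotonicity reaches the others.\<close>
      moreover have "real n * q x \<le> q (x [^] n)"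
      proof (rule le_q)
        fix k
        have "real n * q x \<le> real n * g x k"
          using q_le[of x k] by (intro mult_left_mono) auto
        also have "\<dots> = g (x [^] n) (k * n)" by (simp add: g_pow)
        also have "\<dots> \<le> g (x [^] n) k" using False by (intro antimono_g) auto
        finally show "real n * q x \<le> g (x [^] n) k" .
      qed simp
      ultimately show ?thesis using False by (simp add: field_simps)
    qed
  qed
  show "q z \<le> p z" if "z \<in> carrier G" for z
    using q_le[OF that, of 0] that by (simp add: g_def)
  show "q z \<le> p (z \<otimes> a) - p a" if "z \<in> carrier G" for z
    using q_le[OF that, of 1] that by (simp add: g_def)
  show "q z = p z" if "z \<notin> carrier G" for z
    using that by (simp add: q_def)
qed

lemma (in group) sublinear_INF_chain:
  assumes "C \<noteq> {}" and sub: "\<And>p. p \<in> C \<Longrightarrow> sublinear G p"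
    and chain: "\<And>p p'. p \<in> C \<Longrightarrow> p' \<in> C \<Longrightarrow> p \<le> p' \<or> p' \<le> p"
    and bdd: "\<And>x. x \<in> carrier G \<Longrightarrow> bdd_below ((\<lambda>p. p x) ` C)"
  shows "sublinear G (\<lambda>x. INF p\<in>C. p x)"
proof -
  define u where "u x = (INF p\<in>C. p x)" for x
  have u_le: "u x \<le> p x" if "x \<in> carrier G" "p \<in> C" for x p
    using cINF_lower[OF bdd] that by (simp add: u_def)
  have le_u: "c \<le> u x" if "\<And>p. p \<in> C \<Longrightarrow> c \<le> p x" for c x
    using that \<open>C \<noteq> {}\<close> by (auto simp: u_def intro!: cINF_greatest)
  have "sublinear G u"
    unfolding sublinear_def
  proof (intro conjI ballI allI)
    fix x y assume [simp]: "x \<in> carrier G" "y \<in> carrier G"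
    have sum: "u (x \<otimes> y) \<le> p x + p' y" if "p \<in> C" "p' \<in> C" for p p'
    proof -
      have "p \<le> p' \<or> p' \<le> p" using that by (rule chain)
      then obtain r where "r \<in> C" "r \<le> p" "r \<le> p'"
        using \<open>p \<in> C\<close> \<open>p' \<in> C\<close> by blast
      then have "u (x \<otimes> y) \<le> r x + r y"
        using u_le[of "x \<otimes> y" r] sublinear_mult[OF sub, of r x y] by simp
      also have "\<dots> \<le> p x + p' y"
        using \<open>r \<le> p\<close> \<open>r \<le> p'\<close> by (simp add: le_fun_def add_mono)
      finally show ?thesis .
    qed
    have "u (x \<otimes> y) - p x \<le> u y" if "p \<in> C" for p
      by (rule le_u) (use sum[OF that] in \<open>auto simp: algebra_simps\<close>)
    then have "u (x \<otimes> y) - u y \<le> u x"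
      by (intro le_u) (auto simp: algebra_simps)
    then show "u (x \<otimes> y) \<le> u x + u y" by simp
  next
    fix x and n :: nat assume [simp]: "x \<in> carrier G"
    have pow: "p (x [^] n) = real n * p x" if "p \<in> C" for p
      using sublinear_pow[OF sub[OF that], of x n] by simp
    show "u (x [^] n) = real n * u x"
    proof (cases "n = 0")
      case True
      have "u \<one> = (INF p\<in>C. 0)"
        unfolding u_def by (rule INF_cong) (simp_all add: sublinear_one sub)
      then show ?thesis using True \<open>C \<noteq> {}\<close> by simp
    next
      case False
      have "u (x [^] n) / real n \<le> u x"
        by (rule le_u) (use u_le[of "x [^] n"] pow False in \<open>auto simp: field_simps\<close>)
      moreover have "real n * u x \<le> u (x [^] n)"
      proof (rule le_u)
        fix p assume "p \<in> C"
        then show "real n * u x \<le> p (x [^] n)"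
          using u_le[of x p] pow[of p] by (simp add: mult_left_mono)
      qed
      ultimately show ?thesis using False by (simp add: field_simps)
    qed
  qed
  then show ?thesis by (simp add: u_def[abs_def])
qed

text \<open>Zorn's lemma yields a minimal sublinear function below \<open>q\<close>, which must be additive.\<close>

lemma (in comm_group) additive_below_sublinear:
  assumes q: "sublinear G q"
  obtains f where "\<And>x y. x \<in> carrier G \<Longrightarrow> y \<in> carrier G \<Longrightarrow> f (x \<otimes> y) = f x + f y"
    "\<And>x. x \<in> carrier G \<Longrightarrow> f x \<le> q x"
proof -
  \<comment> \<open>Fixing the values outside the carrier makes the order of functions on the whole type agree
    with the order on the carrier.\<close>
  define S where "S = {p. sublinear G p \<and> p \<le> q \<and> (\<forall>x. x \<notin> carrier G \<longrightarrow> p x = q x)}"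
  have "\<exists>f\<in>S. \<forall>p\<in>S. p \<le> f \<longrightarrow> p = f"
  proof (rule predicate_Zorn)
    show "partial_order_on S (relation_of (\<lambda>p p'. p' \<le> p) S)"
      by (rule partial_order_on_relation_ofI) auto
  next
    fix C assume "C \<in> Chains (relation_of (\<lambda>p p'. p' \<le> p) S)"
    then have CS: "C \<subseteq> S" and chain: "\<And>p p'. p \<in> C \<Longrightarrow> p' \<in> C \<Longrightarrow> p \<le> p' \<or> p' \<le> p"
      by (auto simp: Chains_def relation_of_def)
    show "\<exists>u\<in>S. \<forall>p\<in>C. u \<le> p"
    proof (cases "C = {}")
      case True
      then show ?thesis using q by (auto simp: S_def)
    next
      case False
      have bdd: "bdd_below ((\<lambda>p. p x) ` C)" for x
      proof (cases "x \<in> carrier G")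
        case True
        have "- q (inv x) \<le> p x" if "p \<in> C" for p
        proof -
          have "sublinear G p" "p (inv x) \<le> q (inv x)"
            using CS that by (auto simp: S_def le_fun_def)
          then show ?thesis using sublinear_ge_uminus_inv[of p x] True by simp
        qed
        then show ?thesis by (rule bdd_belowI2)
      next
        case False
        then have "q x \<le> p x" if "p \<in> C" for p
          using CS that by (auto simp: S_def)
        then show ?thesis by (rule bdd_belowI2)
      qed
      define u where "u x = (INF p\<in>C. p x)" for x
      have u_le: "u \<le> p" if "p \<in> C" for p
        using cINF_lower[OF bdd that] by (simp add: u_def le_fun_def)
      have "sublinear G u"
        unfolding u_def using False CS chain bdd
        by (intro sublinear_INF_chain) (auto simp: S_def)
      moreover have "u \<le> q"
        using False CS u_le by (fastforce simp: S_def)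
      moreover have "u x = q x" if "x \<notin> carrier G" for x
      proof -
        have "u x = (INF p\<in>C. q x)"
          unfolding u_def by (rule INF_cong) (use CS that in \<open>auto simp: S_def\<close>)
        then show ?thesis using False by simp
      qed
      ultimately show ?thesis using u_le by (auto simp: S_def)
    qed
  qed
  then obtain f where f: "f \<in> S" and minimal: "\<And>p. p \<in> S \<Longrightarrow> p \<le> f \<Longrightarrow> p = f"
    by blast
  have sub: "sublinear G f" using f by (simp add: S_def)
  have "f (x \<otimes> y) = f x + f y" if x: "x \<in> carrier G" and y: "y \<in> carrier G" for x y
  proof -
    obtain p where p: "sublinear G p" "\<And>z. z \<in> carrier G \<Longrightarrow> p z \<le> f z"
      "\<And>z. z \<in> carrier G \<Longrightarrow> p z \<le> f (z \<otimes> y) - f y" "\<And>z. z \<notin> carrier G \<Longrightarrow> p z = f z"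
      by (rule sublinear_reduction[OF sub y]) blast
    have "p \<le> f"
      unfolding le_fun_def using p(2,4) by (metis order_refl)
    moreover have "p \<in> S"
      using p \<open>p \<le> f\<close> f by (auto simp: S_def)
    ultimately have "p = f" by (intro minimal)
    then have "f x \<le> f (x \<otimes> y) - f y" using p(3)[OF x] by simp
    then show ?thesis using sublinear_mult[OF sub x y] by simp
  qed
  moreover have "f x \<le> q x" for x using f by (simp add: S_def le_fun_def)
  ultimately show ?thesis using that by blast
qed

text \<open>
  An additive function below the reduction \<open>q\<close> of \<open>p\<close> at \<open>a\<close> satisfies
  \<open>- f a = f (inv a) \<le> q (inv a) \<le> - p a\<close>.
\<close>

lemma (in comm_group) Hahn_Banach_sublinear:
  assumes p: "sublinear G p" and a: "a \<in> carrier G"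
  obtains f where "\<And>x y. x \<in> carrier G \<Longrightarrow> y \<in> carrier G \<Longrightarrow> f (x \<otimes> y) = f x + f y"
    "\<And>x. x \<in> carrier G \<Longrightarrow> f x \<le> p x" "f a = p a"
proof -
  obtain q where q: "sublinear G q" "\<And>z. z \<in> carrier G \<Longrightarrow> q z \<le> p z"
    "\<And>z. z \<in> carrier G \<Longrightarrow> q z \<le> p (z \<otimes> a) - p a"
    using sublinear_reduction[OF p a] by metis
  obtain f where f: "\<And>x y. x \<in> carrier G \<Longrightarrow> y \<in> carrier G \<Longrightarrow> f (x \<otimes> y) = f x + f y"
    "\<And>x. x \<in> carrier G \<Longrightarrow> f x \<le> q x"
    using additive_below_sublinear[OF q(1)] by metis
  have "f \<one> = 0" using f(1)[of \<one> \<one>] by simp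
  then have "f (inv a) = - f a" using f(1)[of a "inv a"] a by simp
  moreover have "q (inv a) \<le> - p a"
    using q(3)[of "inv a"] a by (simp add: sublinear_one[OF p])
  ultimately have "p a \<le> f a" using f(2)[of "inv a"] a by simp
  moreover have le: "f x \<le> p x" if "x \<in> carrier G" for x
    using f(2) q(2) that by force
  ultimately have "f a = p a" using a by (simp add: order_antisym)
  then show ?thesis using that f(1) le by blast
qed

section \<open>Norming additive functionals\<close>

context homogeneous_pseudo_length
begin

text \<open>
  The additive functionals bounded by \<open>l\<close>, with arbitrary values outside the carrier of \<open>G\<close>.
\<close>

definition dominated_functionals :: "('a \<Rightarrow> real) set" where
  "dominated_functionals =
     {f. (\<forall>x\<in>carrier G. \<forall>y\<in>carrier G. f (x \<otimes> y) = f x + f y) \<and> (\<forall>x\<in>carrier G. \<bar>f x\<bar> \<le> l x)}"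

text \<open>The Hahn-Banach theorem applies to \<open>L\<close>, the function that \<open>l\<close> induces on the abelianization.\<close>

lemma norming_functional:
  assumes a: "a \<in> carrier G"
  obtains f where "f \<in> dominated_functionals" "f a = l a"
proof -
  define K where "K = derived G (carrier G)"
  interpret K: normal K G
    unfolding K_def by (rule derived_self_is_normal)
  interpret Q: comm_group "G Mod K"
    unfolding K_def by (rule derived_quot_is_comm_group)
  have length_coset: "l x \<le> l y"
    if "x \<in> carrier G" "y \<in> carrier G" "K #> x = K #> y" for x y
  proof -
    have "x \<in> K #> y" using that rcos_self[OF that(1) K.subgroup_axioms] by simp
    then obtain k where k: "k \<in> K" "x = k \<otimes> y" by (auto simp: r_coset_def)
    then have "l x \<le> l k + l y" using length_mult[of k y] that K.subset by auto
    then show ?thesis using length_derived[of k] k by (simp add: K_def)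
  qed
  define L where "L A = l (SOME x. x \<in> carrier G \<and> A = K #> x)" for A
  have L: "L (K #> x) = l x" if x: "x \<in> carrier G" for x
  proof -
    define y where "y = (SOME y. y \<in> carrier G \<and> K #> x = K #> y)"
    have "y \<in> carrier G \<and> K #> x = K #> y"
      unfolding y_def by (rule someI_ex) (use x in auto)
    then have "l y = l x" using length_coset[of x y] length_coset[of y x] x by simp
    then show ?thesis by (simp add: L_def y_def)
  qed
  have subL: "sublinear (G Mod K) L"
    unfolding sublinear_def carrier_FactGroup
    by (auto simp: L K.rcos_sum K.FactGroup_pow length_mult length_nat_pow)
  have "K #> a \<in> carrier (G Mod K)" using a by (simp add: carrier_FactGroup)
  with subL obtain F where F:
      "\<And>A B. A \<in> carrier (G Mod K) \<Longrightarrow> B \<in> carrier (G Mod K) \<Longrightarrow> F (A \<otimes>\<^bsub>G Mod K\<^esub> B) = F A + F B"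
      "\<And>A. A \<in> carrier (G Mod K) \<Longrightarrow> F A \<le> L A" "F (K #> a) = L (K #> a)"
    by (rule Q.Hahn_Banach_sublinear) blast
  define f where "f x = F (K #> x)" for x
  have add: "f (x \<otimes> y) = f x + f y" if "x \<in> carrier G" "y \<in> carrier G" for x y
    using F(1)[of "K #> x" "K #> y"] that by (simp add: f_def carrier_FactGroup K.rcos_sum)
  have le: "f x \<le> l x" if "x \<in> carrier G" for x
    using F(2)[of "K #> x"] that by (simp add: f_def carrier_FactGroup L)
  have "f \<one> = 0" using add[of \<one> \<one>] by simp
  then have "f (inv x) = - f x" if "x \<in> carrier G" for x
    using add[of x "inv x"] that by simp
  then have "\<bar>f x\<bar> \<le> l x" if "x \<in> carrier G" for x
    using le[of x] le[of "inv x"] that by (simp add: length_inv abs_le_iff)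
  then have "f \<in> dominated_functionals" using add by (simp add: dominated_functionals_def)
  moreover have "f a = l a" using F(3) a by (simp add: f_def L)
  ultimately show ?thesis by (rule that)
qed

end

section \<open>The Banach space of bounded functions\<close>

text \<open>
  The space of all bounded real functions on a type, with pointwise operations. The fields
  \<open>mult\<close> and \<open>one\<close>, of no importance for a module, are filled with the pointwise product and the
  constant function 1.
\<close>

definition bounded_functions :: "(real, 'i \<Rightarrow> real) module" where
  "bounded_functions =
     \<lparr>carrier = {f. bounded (range f)}, monoid.mult = (\<lambda>f g i. f i * g i), one = (\<lambda>i. 1),
      ring.zero = (\<lambda>i. 0), ring.add = (\<lambda>f g i. f i + g i), module.smult = (\<lambda>c f i. c * f i)\<rparr>"

text \<open>The supremum norm; it is meaningful for bounded functions only.\<close>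

definition sup_norm :: "('i \<Rightarrow> real) \<Rightarrow> real" where
  "sup_norm f = (SUP i. \<bar>f i\<bar>)"

lemma bounded_functions_simps [simp]:
  "f \<in> carrier bounded_functions \<longleftrightarrow> bounded (range f)"
  "f \<oplus>\<^bsub>bounded_functions\<^esub> g = (\<lambda>i. f i + g i)"
  "\<zero>\<^bsub>bounded_functions\<^esub> = (\<lambda>i. 0)"
  "c \<odot>\<^bsub>bounded_functions\<^esub> f = (\<lambda>i. c * f i)"
  by (simp_all add: bounded_functions_def)

lemma abs_le_sup_norm:
  assumes "bounded (range f)"
  shows "\<bar>f i\<bar> \<le> sup_norm f"
proof -
  have "bdd_above (range (\<lambda>i. \<bar>f i\<bar>))"
    using assms by (force simp: bounded_iff intro: bdd_aboveI)
  then show ?thesis unfolding sup_norm_def by (intro cSUP_upper) auto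
qed

lemma sup_norm_le: "(\<And>i. \<bar>f i\<bar> \<le> c) \<Longrightarrow> sup_norm f \<le> c"
  unfolding sup_norm_def by (rule cSUP_least) auto

lemma real_normed_space_bounded_functions:
  "real_normed_space (bounded_functions :: (real, 'i \<Rightarrow> real) module) sup_norm"
proof -
  let ?B = "bounded_functions :: (real, 'i \<Rightarrow> real) module"
  have scale: "bounded (range (\<lambda>i. c * f i))" if "bounded (range f)" for c and f :: "'i \<Rightarrow> real"
    using bounded_scaling[OF that, of c] by (simp add: image_image)
  have "abelian_group ?B"
  proof (rule abelian_groupI)
    fix f assume "f \<in> carrier ?B"
    then show "\<exists>g\<in>carrier ?B. g \<oplus>\<^bsub>?B\<^esub> f = \<zero>\<^bsub>?B\<^esub>"
      using scale[of f "-1"] by (intro bexI[of _ "\<lambda>i. - f i"]) auto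
  qed (simp_all add: bounded_plus_comp add_ac)
  then have "module real_field ?B"
    by (intro moduleI cring_real_field)
      (simp_all add: real_field_def scale algebra_simps)
  then show ?thesis
  proof (intro real_normed_space.intro real_normed_space_axioms.intro)
    fix f assume "f \<in> carrier ?B"
    then have f: "bounded (range f)" by simp
    show "0 \<le> sup_norm f"
      using abs_le_sup_norm[OF f, of undefined] by linarith
    show "sup_norm f = 0 \<longleftrightarrow> f = \<zero>\<^bsub>?B\<^esub>"
      using abs_le_sup_norm[OF f] by (auto simp: fun_eq_iff sup_norm_def)
    show "sup_norm (c \<odot>\<^bsub>?B\<^esub> f) = \<bar>c\<bar> * sup_norm f" for c
    proof (cases "c = 0")
      case False
      have "\<bar>f i\<bar> \<le> sup_norm (\<lambda>i. c * f i) / \<bar>c\<bar>" for i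
        using abs_le_sup_norm[OF scale[OF f, of c], of i] False
        by (simp add: abs_mult field_simps)
      then have "sup_norm f \<le> sup_norm (\<lambda>i. c * f i) / \<bar>c\<bar>"
        by (rule sup_norm_le)
      then have "\<bar>c\<bar> * sup_norm f \<le> sup_norm (\<lambda>i. c * f i)"
        using False by (simp add: field_simps)
      moreover have "sup_norm (\<lambda>i. c * f i) \<le> \<bar>c\<bar> * sup_norm f"
        by (rule sup_norm_le) (simp add: abs_mult mult_left_mono abs_le_sup_norm[OF f])
      ultimately show ?thesis by simp
    qed (simp add: sup_norm_def)
  next
    fix f g assume "f \<in> carrier ?B" "g \<in> carrier ?B"
    then have "\<bar>f i\<bar> \<le> sup_norm f" "\<bar>g i\<bar> \<le> sup_norm g" for i
      by (simp_all add: abs_le_sup_norm)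
    then show "sup_norm (f \<oplus>\<^bsub>?B\<^esub> g) \<le> sup_norm f + sup_norm g"
      by (auto intro!: sup_norm_le intro: order_trans[OF abs_triangle_ineq add_mono])
  qed
qed

lemma minus_bounded_functions:
  assumes "bounded (range f)" "bounded (range g)"
  shows "f \<ominus>\<^bsub>bounded_functions\<^esub> g = (\<lambda>i. f i - g i)"
proof -
  interpret real_normed_space "bounded_functions" sup_norm
    by (rule real_normed_space_bounded_functions)
  have "\<ominus>\<^bsub>bounded_functions\<^esub> g = (\<lambda>i. - g i)"
    using assms bounded_scaling[OF assms(2), of "-1"]
    by (intro M.minus_equality) (auto simp: image_image)
  then show ?thesis by (simp add: a_minus_def)
qed

text \<open>
  A Cauchy sequence converges pointwise, and its uniform Cauchy bounds pass to the limit.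
\<close>

lemma real_banach_space_bounded_functions:
  "real_banach_space (bounded_functions :: (real, 'i \<Rightarrow> real) module) sup_norm"
proof -
  let ?B = "bounded_functions :: (real, 'i \<Rightarrow> real) module"
  interpret real_normed_space ?B sup_norm
    by (rule real_normed_space_bounded_functions)
  have "\<exists>g\<in>carrier ?B. (\<lambda>n. sup_norm (\<sigma> n \<ominus>\<^bsub>?B\<^esub> g)) \<longlonglongrightarrow> 0"
    if "range \<sigma> \<subseteq> carrier ?B"
      and cauchy: "\<forall>\<epsilon>>0. \<exists>N. \<forall>m\<ge>N. \<forall>n\<ge>N. sup_norm (\<sigma> m \<ominus>\<^bsub>?B\<^esub> \<sigma> n) < \<epsilon>"
    for \<sigma>
  proof -
    have bounded: "bounded (range (\<sigma> n))" for n
      using that(1) by (auto simp: image_subset_iff)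
    have close: "\<exists>N. \<forall>m\<ge>N. \<forall>n\<ge>N. \<forall>i. \<bar>\<sigma> m i - \<sigma> n i\<bar> < \<epsilon>" if "0 < \<epsilon>" for \<epsilon>
    proof -
      obtain N where N: "\<And>m n. m \<ge> N \<Longrightarrow> n \<ge> N \<Longrightarrow> sup_norm (\<sigma> m \<ominus>\<^bsub>?B\<^esub> \<sigma> n) < \<epsilon>"
        using cauchy \<open>0 < \<epsilon>\<close> by blast
      have "\<bar>\<sigma> m i - \<sigma> n i\<bar> < \<epsilon>" if "m \<ge> N" "n \<ge> N" for m n i
        using N[OF that] abs_le_sup_norm[OF bounded_minus_comp[OF bounded[of m] bounded[of n]], where i = i]
        by (simp add: minus_bounded_functions[OF bounded bounded])
      then show ?thesis by blast
    qed
    have "Cauchy (\<lambda>n. \<sigma> n i)" for i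
      unfolding Cauchy_def dist_real_def using close by meson
    then have "\<exists>y. (\<lambda>n. \<sigma> n i) \<longlonglongrightarrow> y" for i
      by (simp add: Cauchy_convergent_iff convergent_def)
    then obtain g where g: "\<And>i. (\<lambda>n. \<sigma> n i) \<longlonglongrightarrow> g i" by metis
    have limit: "\<exists>N. \<forall>n\<ge>N. \<forall>i. \<bar>\<sigma> n i - g i\<bar> \<le> \<epsilon>" if "0 < \<epsilon>" for \<epsilon>
    proof -
      obtain N where N: "\<And>m n i. m \<ge> N \<Longrightarrow> n \<ge> N \<Longrightarrow> \<bar>\<sigma> m i - \<sigma> n i\<bar> < \<epsilon>"
        using close[OF \<open>0 < \<epsilon>\<close>] by blast
      have "\<bar>\<sigma> n i - g i\<bar> \<le> \<epsilon>" if "n \<ge> N" for n i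
      proof (rule tendsto_upperbound)
        show "(\<lambda>m. \<bar>\<sigma> n i - \<sigma> m i\<bar>) \<longlonglongrightarrow> \<bar>\<sigma> n i - g i\<bar>"
          by (intro tendsto_intros g)
        show "\<forall>\<^sub>F m in sequentially. \<bar>\<sigma> n i - \<sigma> m i\<bar> \<le> \<epsilon>"
          unfolding eventually_sequentially using N[OF that] by (meson less_imp_le)
      qed simp
      then show ?thesis by blast
    qed
    have bounded_g: "bounded (range g)"
    proof -
      obtain N where N: "\<And>i. \<bar>\<sigma> N i - g i\<bar> \<le> 1" using limit[of 1] by auto
      obtain c where c: "\<And>i. \<bar>\<sigma> N i\<bar> \<le> c"
        using bounded[of N] by (auto simp: bounded_iff)
      have "\<bar>g i\<bar> \<le> c + 1" for i using c[of i] N[of i] by linarith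
      then show ?thesis by (auto simp: bounded_iff)
    qed
    have "(\<lambda>n. sup_norm (\<sigma> n \<ominus>\<^bsub>?B\<^esub> g)) \<longlonglongrightarrow> 0"
    proof (rule LIMSEQ_I)
      fix \<epsilon> :: real assume "0 < \<epsilon>"
      then obtain N where N: "\<And>n i. n \<ge> N \<Longrightarrow> \<bar>\<sigma> n i - g i\<bar> \<le> \<epsilon> / 2"
        using limit[of "\<epsilon> / 2"] by auto
      have "norm (sup_norm (\<sigma> n \<ominus>\<^bsub>?B\<^esub> g) - 0) < \<epsilon>" if "n \<ge> N" for n
      proof -
        have "sup_norm (\<sigma> n \<ominus>\<^bsub>?B\<^esub> g) \<le> \<epsilon> / 2"
          unfolding minus_bounded_functions[OF bounded bounded_g]
          by (rule sup_norm_le) (rule N[OF that])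
        moreover have "0 \<le> sup_norm (\<sigma> n \<ominus>\<^bsub>?B\<^esub> g)"
          unfolding minus_bounded_functions[OF bounded bounded_g]
          using bounded_minus_comp[OF bounded bounded_g] by (intro nrm_nonneg) simp
        ultimately show ?thesis using \<open>0 < \<epsilon>\<close> by simp
      qed
      then show "\<exists>N. \<forall>n\<ge>N. norm (sup_norm (\<sigma> n \<ominus>\<^bsub>?B\<^esub> g) - 0) < \<epsilon>" by blast
    qed
    then show ?thesis using bounded_g by auto
  qed
  then have "Metric_space.mcomplete (carrier ?B) (norm_dist ?B sup_norm)"
    unfolding mcomplete_norm_dist_iff by blast
  then show ?thesis by unfold_locales
qed

section \<open>The isometric homomorphism\<close>

theorem theorem1p2:
  fixes G :: "('a, 'm) monoid_scheme" and l :: "'a \<Rightarrow> real"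
  assumes "group G"
    and "pseudo_length_function G l"
    and "homogeneous G l"
  shows "\<exists>(B :: (real, ('a \<Rightarrow> real) \<Rightarrow> real) module) nrm \<phi>.
           real_banach_space B nrm \<and>
           \<phi> \<in> hom G (add_monoid B) \<and>
           (\<forall>x\<in>carrier G. l x = nrm (\<phi> x)) \<and>
           (length_function G l \<longrightarrow> inj_on \<phi> (carrier G))"
proof -
  interpret homogeneous_pseudo_length G l
    using assms by (simp add: homogeneous_pseudo_length_def homogeneous_pseudo_length_axioms_def)
  let ?B = "bounded_functions :: (real, ('a \<Rightarrow> real) \<Rightarrow> real) module"
  \<comment> \<open>Evaluation at \<open>x\<close>, extended by 0 to functions that are not dominated functionals; this leaves
    the supremum norm unchanged.\<close>
  define \<phi> :: "'a \<Rightarrow> ('a \<Rightarrow> real) \<Rightarrow> real"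
    where "\<phi> x f = (if f \<in> dominated_functionals then f x else 0)" for x f
  have add: "\<phi> (x \<otimes>\<^bsub>G\<^esub> y) = (\<lambda>f. \<phi> x f + \<phi> y f)" if "x \<in> carrier G" "y \<in> carrier G" for x y
    using that by (auto simp: \<phi>_def dominated_functionals_def)
  have le: "\<bar>\<phi> x f\<bar> \<le> l x" if "x \<in> carrier G" for x f
    using that by (simp add: \<phi>_def dominated_functionals_def length_nonneg)
  then have bounded: "bounded (range (\<phi> x))" if "x \<in> carrier G" for x
    using that by (force simp: bounded_iff)
  have norm: "l x = sup_norm (\<phi> x)" if x: "x \<in> carrier G" for x
  proof (rule antisym)
    obtain f where "f \<in> dominated_functionals" "f x = l x"
      using norming_functional[OF x] .
    then show "l x \<le> sup_norm (\<phi> x)"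
      using abs_le_sup_norm[OF bounded[OF x], of f] by (simp add: \<phi>_def)
    show "sup_norm (\<phi> x) \<le> l x" by (rule sup_norm_le) (rule le[OF x])
  qed
  have "inj_on \<phi> (carrier G)" if "length_function G l"
  proof (rule inj_onI)
    fix x y assume xy: "x \<in> carrier G" "y \<in> carrier G" "\<phi> x = \<phi> y"
    let ?z = "x \<otimes>\<^bsub>G\<^esub> inv\<^bsub>G\<^esub> y"
    have "\<phi> x = (\<lambda>f. \<phi> ?z f + \<phi> y f)"
      using add[of ?z y] xy by (simp add: m_assoc)
    then have "\<phi> ?z = (\<lambda>f. 0)" using xy(3) by (simp add: fun_eq_iff)
    then have "l ?z = 0" using norm[of ?z] xy by (simp add: sup_norm_def)
    then have "?z = \<one>\<^bsub>G\<^esub>"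
      using that xy unfolding length_function_def
      by (metis DiffI inv_closed less_irrefl m_closed singletonD)
    then show "x = y" using xy by (simp add: inv_solve_right')
  qed
  moreover have "\<phi> \<in> hom G (add_monoid ?B)"
    by (rule homI) (simp_all add: add bounded)
  ultimately show ?thesis
    using real_banach_space_bounded_functions norm by blast
qed

end
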